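(* $r(K_5-e,K_6-K_{1,s})=r(K_5-e,K_5)$ for $s=3$ and for $s=4$.
   Context: Graphs are finite and simple. For graphs $G$ and $H$, $r(G,H)$ is the smallest integer $N$ such that for every $n\ge N$ and every coloring of the edges of the complete graph $K_n$ with red and blue there is either a red copy of $G$ or a blue copy of $H$ (copies are subgraphs, not necessarily induced). $K_n-e$ is the complete graph on $n$ vertices with one edge deleted. For $s\le n-1$, $K_n-K_{1,s}$ is the graph obtained from $K_n$ by deleting the edges of a star $K_{1,s}$, i.e. deleting $s$ edges all incident to one common vertex. *)

theory Defs
  imports "HOL-Library.Ramsey"
begin

type_synonym 'a graph = "'a set \<times> 'a set set"

abbreviation verts :: "'a graph \<Rightarrow> 'a set" where "verts \<equiv> fst"
abbreviation edges :: "'a graph \<Rightarrow> 'a set set" where "edges \<equiv> snd"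

definition simple_graph :: "'a graph \<Rightarrow> bool" where
  "simple_graph G \<longleftrightarrow> finite (verts G) \<and> edges G \<subseteq> [verts G]\<^bsup>2\<^esup>"

definition contains_copy :: "'a graph \<Rightarrow> 'b graph \<Rightarrow> bool" where
  "contains_copy G H \<longleftrightarrow>
     (\<exists>f. inj_on f (verts H) \<and> f ` verts H \<subseteq> verts G \<and> (\<forall>e\<in>edges H. f ` e \<in> edges G))"

definition complete_graph :: "nat \<Rightarrow> nat graph" where
  "complete_graph n = ({..<n}, [{..<n}]\<^bsup>2\<^esup>)"

definition delete_edges :: "'a graph \<Rightarrow> 'a set set \<Rightarrow> 'a graph" where
  "delete_edges G F = (verts G, edges G - F)"

text \<open>All edges of \<open>K\<^sub>n\<close> are equivalent under relabelling, so a fixed one is deleted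
  (intended for \<open>n \<ge> 2\<close>).\<close>

definition complete_minus_edge :: "nat \<Rightarrow> nat graph" where
  "complete_minus_edge n = delete_edges (complete_graph n) {{0, 1}}"

text \<open>Likewise the deleted star has centre \<open>0\<close> and the \<open>s\<close> leaves \<open>1, \<dots>, s\<close>
  (intended for \<open>s \<le> n - 1\<close>).\<close>

definition complete_minus_star :: "nat \<Rightarrow> nat \<Rightarrow> nat graph" where
  "complete_minus_star n s = delete_edges (complete_graph n) ((\<lambda>i. {0, i}) ` {1..s})"

text \<open>A red/blue colouring of \<open>K\<^sub>n\<close> is given by its set \<open>R\<close> of red edges; the other edges are blue.\<close>

definition ramsey_arrows :: "nat \<Rightarrow> 'a graph \<Rightarrow> 'b graph \<Rightarrow> bool" where
  "ramsey_arrows n G H \<longleftrightarrow>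
     (\<forall>R \<subseteq> edges (complete_graph n).
        contains_copy (verts (complete_graph n), R) G \<or>
        contains_copy (verts (complete_graph n), edges (complete_graph n) - R) H)"

definition ramsey_number :: "'a graph \<Rightarrow> 'b graph \<Rightarrow> nat" where
  "ramsey_number G H = (LEAST N. \<forall>n\<ge>N. ramsey_arrows n G H)"

lemma simple_graph_complete_minus_edge: "simple_graph (complete_minus_edge n)"
  by (auto simp: simple_graph_def complete_minus_edge_def delete_edges_def complete_graph_def)

lemma simple_graph_complete_minus_star: "simple_graph (complete_minus_star n s)"
  by (auto simp: simple_graph_def complete_minus_star_def delete_edges_def complete_graph_def)

lemma card_edges_complete_minus_star:
  assumes "s < n"
  shows "card (edges (complete_minus_star n s)) = (n choose 2) - s"
proof -
  have "inj_on (\<lambda>i. {0::nat, i}) {1..s}"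
    by (auto simp: inj_on_def doubleton_eq_iff)
  then have "card ((\<lambda>i. {0::nat, i}) ` {1..s}) = s"
    by (simp add: card_image)
  moreover have "(\<lambda>i. {0::nat, i}) ` {1..s} \<subseteq> [{..<n}]\<^bsup>2\<^esup>"
    using assms by auto
  moreover have "card ([{..<n}]\<^bsup>2\<^esup>) = n choose 2"
    by (simp add: nsets_def finite_subset[OF _ finite_lessThan] n_subsets conj_commute cong: conj_cong)
  ultimately show ?thesis
    by (simp add: complete_minus_star_def delete_edges_def complete_graph_def card_Diff_subset)
qed

lemma copy_into_complete:
  assumes "simple_graph H" and "finite C" and "card C = card (verts H)" and "C \<subseteq> V"
    and "\<And>x y. x \<in> C \<Longrightarrow> y \<in> C \<Longrightarrow> x \<noteq> y \<Longrightarrow> {x, y} \<in> E"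
  shows "contains_copy (V, E) H"
proof -
  have "finite (verts H)"
    using assms(1) by (simp add: simple_graph_def)
  then obtain f where f: "bij_betw f (verts H) C"
    using assms(2,3) finite_same_card_bij by metis
  have "f ` e \<in> E" if "e \<in> edges H" for e
  proof -
    have "e \<in> [verts H]\<^bsup>2\<^esup>"
      using assms(1) that by (auto simp: simple_graph_def)
    then obtain x y where xy: "e = {x, y}" "x \<in> verts H" "y \<in> verts H" "x \<noteq> y"
      by (rule nsets2_E)
    then show ?thesis
      using f assms(5)[of "f x" "f y"] by (auto simp: bij_betw_def inj_on_def)
  qed
  then show ?thesis
    using f assms(4) by (auto simp: contains_copy_def bij_betw_def intro!: exI[of _ f])
qed

text \<open>Well-definedness of \<^const>\<open>ramsey_number\<close>: the least element exists.\<close>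

lemma ramsey_number_exists:
  assumes "simple_graph G" and "simple_graph H"
  shows "\<exists>N. \<forall>n\<ge>N. ramsey_arrows n G H"
proof -
  obtain r where r: "\<And>(V :: nat set) E. finite V \<Longrightarrow> card V \<ge> r \<Longrightarrow>
      \<exists>C \<subseteq> V. card C = card (verts G) \<and> clique C E \<or> card C = card (verts H) \<and> indep C E"
    using ramsey2[of "card (verts G)" "card (verts H)"] by metis
  have "ramsey_arrows n G H" if "n \<ge> r" for n
    unfolding ramsey_arrows_def
  proof (intro allI impI)
    fix R assume "R \<subseteq> edges (complete_graph n)"
    obtain C where C: "C \<subseteq> {..<n}"
      "card C = card (verts G) \<and> clique C R \<or> card C = card (verts H) \<and> indep C R"
      using r[of "{..<n}" R] \<open>n \<ge> r\<close> by auto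
    have "finite C"
      using C(1) finite_subset by blast
    from C(2) show "contains_copy (verts (complete_graph n), R) G \<or>
        contains_copy (verts (complete_graph n), edges (complete_graph n) - R) H"
    proof
      assume *: "card C = card (verts G) \<and> clique C R"
      have "contains_copy ({..<n}, R) G"
        by (rule copy_into_complete[OF assms(1) \<open>finite C\<close> _ C(1)]) (use * in \<open>auto simp: clique_def\<close>)
      then show ?thesis
        by (simp add: complete_graph_def)
    next
      assume *: "card C = card (verts H) \<and> indep C R"
      have "contains_copy ({..<n}, [{..<n}]\<^bsup>2\<^esup> - R) H"
        by (rule copy_into_complete[OF assms(2) \<open>finite C\<close> _ C(1)])
          (use * C(1) in \<open>auto simp: indep_def\<close>)
      then show ?thesis
        by (simp add: complete_graph_def)
    qed
  qed
  then show ?thesis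
    by blast
qed

end

theory Submission
  imports Defs
begin

text \<open>Both graphs \<open>K\<^sub>6 - K\<^bsub>1,s\<^esub>\<close> contain \<open>K\<^sub>5\<close>, so only the upper bound needs an argument. Two
  disjoint copies of the line graph of \<open>K\<^sub>5\<close> show \<open>r(K\<^sub>5 - e, K\<^sub>5) > 20\<close>. Now suppose that a colouring
  of \<open>K\<^sub>n\<close>, \<open>n \<ge> 20\<close>, has a blue \<open>K\<^sub>5\<close> on \<open>A\<close> but neither a red \<open>K\<^sub>5 - e\<close> nor a blue
  \<open>K\<^sub>6 - K\<^bsub>1,3\<^esub>\<close>. Every vertex outside \<open>A\<close> sends at most one blue edge to \<open>A\<close>, so a red triangle outside
  \<open>A\<close> would have two common red neighbours in \<open>A\<close>, giving a red \<open>K\<^sub>5 - e\<close>. Hence the at least 15 vertices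
  outside \<open>A\<close> span no red triangle and contain a blue \<open>K\<^sub>5\<close> on some set \<open>B\<close>. Any two vertices outside
  \<open>A \<union> B\<close> have a common red neighbour in \<open>B\<close>, so they are joined in blue; thus there is a blue \<open>K\<^sub>6\<close>.\<close>

section \<open>Copies of complete graphs with edges deleted\<close>

lemma contains_copy_delete_edges_completeI:
  assumes "distinct xs" "length xs = n" "set xs \<subseteq> V"
    and "\<And>i j. i < j \<Longrightarrow> j < n \<Longrightarrow> {i, j} \<notin> F \<Longrightarrow> {xs ! i, xs ! j} \<in> E"
  shows "contains_copy (V, E) (delete_edges (complete_graph n) F)"
  unfolding contains_copy_def
proof (intro exI[of _ "(!) xs"] conjI ballI)
  show "inj_on ((!) xs) (verts (delete_edges (complete_graph n) F))"
    using assms(1,2) by (auto simp: inj_on_def nth_eq_iff_index_eq delete_edges_def complete_graph_def)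
  show "(!) xs ` verts (delete_edges (complete_graph n) F) \<subseteq> verts (V, E)"
    using assms(2,3) by (auto simp: delete_edges_def complete_graph_def)
next
  fix e assume "e \<in> edges (delete_edges (complete_graph n) F)"
  then have e: "e \<in> [{..<n}]\<^bsup>2\<^esup>" "e \<notin> F"
    by (auto simp: delete_edges_def complete_graph_def)
  from e(1) obtain i j where "e = {i, j}" "i < n" "j < n" "i \<noteq> j"
    by (auto elim: nsets2_E)
  then show "(!) xs ` e \<in> edges (V, E)"
    using assms(4)[of i j] assms(4)[of j i] e(2) by (cases "i < j") (auto simp: insert_commute)
qed

text \<open>\<open>x\<close> and \<open>y\<close> play the ends of the deleted edge, so the colour
  of \<open>{x, y}\<close> is left open.\<close>

lemma contains_copy_complete_minus_edge_5I:
  assumes "distinct [x, y, a, b, c]" "{x, y, a, b, c} \<subseteq> V"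
    and "{x, a} \<in> E" "{x, b} \<in> E" "{x, c} \<in> E" "{y, a} \<in> E" "{y, b} \<in> E" "{y, c} \<in> E"
    and "{a, b} \<in> E" "{a, c} \<in> E" "{b, c} \<in> E"
  shows "contains_copy (V, E) (complete_minus_edge 5)"
  unfolding complete_minus_edge_def
proof (rule contains_copy_delete_edges_completeI[of "[x, y, a, b, c]"])
  fix i j :: nat assume "i < j" "j < 5" "{i, j} \<notin> {{0, 1}}"
  then show "{[x, y, a, b, c] ! i, [x, y, a, b, c] ! j} \<in> E"
    using assms(3-) by (auto simp: less_Suc_eq numeral_eq_Suc)
qed (use assms in auto)

text \<open>\<open>v\<close> becomes the star centre, \<open>a\<close> and \<open>b\<close> its two
  remaining neighbours, and the other three vertices of \<open>A\<close> the deleted leaves.\<close>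

lemma contains_copy_complete_minus_star_6_3I:
  assumes "A \<subseteq> V" "card A = 5" "v \<in> V" "v \<notin> A"
    and "\<And>x y. x \<in> A \<Longrightarrow> y \<in> A \<Longrightarrow> x \<noteq> y \<Longrightarrow> {x, y} \<in> E"
    and "a \<in> A" "b \<in> A" "a \<noteq> b" "{v, a} \<in> E" "{v, b} \<in> E"
  shows "contains_copy (V, E) (complete_minus_star 6 3)"
proof -
  have "finite A"
    using assms(2) card.infinite by fastforce
  then have "card (A - {a, b}) = 3"
    using assms(2,6-8) by (simp add: card_Diff_subset)
  then obtain p q r where "A - {a, b} = {p, q, r}" "p \<noteq> q" "q \<noteq> r" "p \<noteq> r"
    by (auto simp: card_3_iff)
  then have *: "distinct [p, q, r, a, b]" "{p, q, r, a, b} = A"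
    using assms(6-8) by auto
  show ?thesis
    unfolding complete_minus_star_def
  proof (rule contains_copy_delete_edges_completeI[of "[v, p, q, r, a, b]"])
    fix i j :: nat assume ij: "i < j" "j < 6" "{i, j} \<notin> (\<lambda>i. {0, i}) ` {1..3}"
    let ?xs = "[v, p, q, r, a, b]"
    show "{?xs ! i, ?xs ! j} \<in> E"
    proof (cases "i = 0")
      case True
      then have "j \<in> {4, 5}"
        using ij by (cases "j \<in> {1..3}") auto
      then show ?thesis
        using True assms(9,10) by auto
    next
      case False
      then have "?xs ! i \<in> A" "?xs ! j \<in> A"
        using ij(1,2) * by (auto simp: less_Suc_eq numeral_eq_Suc)
      moreover have "?xs ! i \<noteq> ?xs ! j"
        using ij(1,2) * assms(4) by (subst nth_eq_iff_index_eq) auto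
      ultimately show ?thesis
        by (rule assms(5))
    qed
  qed (use * assms(1,3,4) in auto)
qed

lemma contains_copy_complete_minus_star_mono:
  assumes "contains_copy G (complete_minus_star n s)" "s \<le> t"
  shows "contains_copy G (complete_minus_star n t)"
proof -
  have "edges (complete_minus_star n t) \<subseteq> edges (complete_minus_star n s)"
    using assms(2) by (auto simp: complete_minus_star_def delete_edges_def)
  moreover have "verts (complete_minus_star n t) = verts (complete_minus_star n s)"
    by (simp add: complete_minus_star_def delete_edges_def)
  ultimately show ?thesis
    using assms(1) unfolding contains_copy_def by (auto 0 4)
qed

text \<open>Vertex \<open>0\<close>, the star centre, lies on every deleted edge; shifting the
  embedding by \<open>Suc\<close> drops it.\<close>

lemma contains_copy_complete_if_minus_star:
  assumes "contains_copy G (complete_minus_star (Suc n) s)"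
  shows "contains_copy G (complete_graph n)"
proof -
  obtain f where f: "inj_on f {..<Suc n}" "f ` {..<Suc n} \<subseteq> verts G"
    "\<And>e. e \<in> [{..<Suc n}]\<^bsup>2\<^esup> \<Longrightarrow> e \<notin> (\<lambda>i. {0, i}) ` {1..s} \<Longrightarrow> f ` e \<in> edges G"
    using assms
    by (auto simp: contains_copy_def complete_minus_star_def delete_edges_def complete_graph_def)
  have "(f \<circ> Suc) ` e \<in> edges G" if "e \<in> [{..<n}]\<^bsup>2\<^esup>" for e
  proof -
    have "Suc ` e \<in> [{..<Suc n}]\<^bsup>2\<^esup>"
      using that by (auto simp: nsets_def card_image)
    then have "f ` Suc ` e \<in> edges G"
      by (rule f(3)) auto
    then show ?thesis
      by (simp add: image_comp)
  qed
  moreover have "inj_on (f \<circ> Suc) {..<n}"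
    using f(1) by (auto simp: inj_on_def)
  moreover have "(f \<circ> Suc) ` {..<n} \<subseteq> verts G"
    using f(2) by auto
  ultimately show ?thesis
    unfolding contains_copy_def complete_graph_def by (intro exI[of _ "f \<circ> Suc"]) auto
qed

section \<open>Upper bound: forcing a blue K_6 - K_{1,3}\<close>

text \<open>This is r(K_3, K_s) \<le> s(s+1)/2. The neighbours of a vertex \<open>v\<close> are
  independent, so either there are enough of them or \<open>v\<close> can be added to an independent
  set among its non-neighbours.\<close>

lemma indep_if_triangle_free:
  assumes "finite V" "s * (s + 1) \<le> 2 * card V"
    and "\<And>x y z. {x, y, z} \<subseteq> V \<Longrightarrow> distinct [x, y, z] \<Longrightarrow>
      {x, y} \<in> E \<Longrightarrow> {x, z} \<in> E \<Longrightarrow> {y, z} \<notin> E"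
  shows "\<exists>C \<subseteq> V. card C = s \<and> indep C E"
  using assms
proof (induction s arbitrary: V)
  case 0
  then show ?case
    by (auto simp: indep_def)
next
  case (Suc s)
  then obtain v where v: "v \<in> V"
    by fastforce
  define N where "N = {u \<in> V. u \<noteq> v \<and> {v, u} \<in> E}"
  have N: "N \<subseteq> V" "finite N" "v \<notin> N"
    using Suc.prems(1) by (auto simp: N_def)
  show ?case
  proof (cases "Suc s \<le> card N")
    case True
    then obtain C where C: "C \<subseteq> N" "card C = Suc s"
      using obtain_subset_with_card_n by metis
    moreover have "indep C E"
      unfolding indep_def
    proof (intro ballI impI)
      fix x y assume "x \<in> C" "y \<in> C" "x \<noteq> y"
      then show "{x, y} \<notin> E"
        using Suc.prems(3)[of v x y] v C(1) by (auto simp: N_def)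
    qed
    ultimately show ?thesis
      using N by blast
  next
    case False
    define W where "W = V - insert v N"
    have "card W = card V - Suc (card N)"
      using v N Suc.prems(1) by (simp add: W_def card_Diff_subset)
    \<comment> \<open>At most s + 1 vertices were removed, and (s+1)(s+2) - 2(s+1) = s(s+1).\<close>
    then have "s * (s + 1) \<le> 2 * card W"
      using Suc.prems(2) False by simp
    then obtain C where C: "C \<subseteq> W" "card C = s" "indep C E"
      using Suc.IH[of W] Suc.prems by (auto simp: W_def)
    have "finite C"
      using C(1) Suc.prems(1) by (auto simp: W_def intro: finite_subset)
    moreover have "v \<notin> C"
      using C(1) by (auto simp: W_def)
    moreover have "indep (insert v C) E"
      using C(1,3) by (auto simp: indep_def W_def N_def insert_commute)
    ultimately show ?thesis
      using C v by (intro exI[of _ "insert v C"]) (auto simp: W_def)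
  qed
qed

lemma ramsey_arrows_minus_star_if_complete:
  assumes arrows: "ramsey_arrows n (complete_minus_edge 5) (complete_graph 5)" and "20 \<le> n"
  shows "ramsey_arrows n (complete_minus_edge 5) (complete_minus_star 6 3)"
  unfolding ramsey_arrows_def
proof (intro allI impI, rule ccontr)
  fix R
  assume R: "R \<subseteq> edges (complete_graph n)"
    and "\<not> (contains_copy (verts (complete_graph n), R) (complete_minus_edge 5) \<or>
      contains_copy (verts (complete_graph n), edges (complete_graph n) - R) (complete_minus_star 6 3))"
  then have no_red: "\<not> contains_copy ({..<n}, R) (complete_minus_edge 5)"
    and no_blue: "\<not> contains_copy ({..<n}, [{..<n}]\<^bsup>2\<^esup> - R) (complete_minus_star 6 3)"
    by (simp_all add: complete_graph_def)
  \<comment> \<open>Two blue edges from \<open>v\<close> to \<open>C\<close> would complete a blue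
    K_6 - K_{1,3}. \<open>C\<close> is arbitrary, as the bound is applied to \<open>A\<close> and
    later to \<open>B\<close>.\<close>
  have few_blue: "card {b \<in> C. {v, b} \<notin> R} \<le> 1"
    if C: "C \<subseteq> {..<n}" "card C = 5" "indep C R" and v: "v < n" "v \<notin> C" for C v
  proof (rule ccontr)
    assume "\<not> ?thesis"
    then have "Suc (Suc 0) \<le> card {b \<in> C. {v, b} \<notin> R}"
      by simp
    then obtain a b where "a \<in> C" "b \<in> C" "a \<noteq> b" "{v, a} \<notin> R" "{v, b} \<notin> R"
      by (auto simp: card_le_Suc_iff)
    with C v have "contains_copy ({..<n}, [{..<n}]\<^bsup>2\<^esup> - R) (complete_minus_star 6 3)"
      by (intro contains_copy_complete_minus_star_6_3I[of C _ v _ a b]) (auto simp: indep_def)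
    with no_blue show False ..
  qed
  obtain A where A: "A \<subseteq> {..<n}" "card A = 5" "indep A R"
  proof -
    have "contains_copy ({..<n}, [{..<n}]\<^bsup>2\<^esup> - R) (complete_graph 5)"
      using arrows R no_red unfolding ramsey_arrows_def complete_graph_def fst_conv snd_conv by blast
    then obtain f where f: "inj_on f {..<5::nat}" "f ` {..<5} \<subseteq> {..<n}"
      "\<And>e. e \<in> [{..<5}]\<^bsup>2\<^esup> \<Longrightarrow> f ` e \<notin> R"
      by (auto simp: contains_copy_def complete_graph_def)
    have "indep (f ` {..<5}) R"
      unfolding indep_def
    proof (safe)
      fix i j :: nat assume "i < 5" "j < 5" "f i \<noteq> f j" "{f i, f j} \<in> R"
      then show False
        using f(3)[of "{i, j}"] by (cases "i = j") auto
    qed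
    then show ?thesis
      using f(1,2) by (intro that[of "f ` {..<5}"]) (auto simp: card_image)
  qed
  have fin: "finite A"
    using A(1) finite_subset by blast
  define W where "W = {..<n} - A"
  have card_W: "card W = n - 5"
    using A fin by (simp add: W_def card_Diff_subset)
  have triangle_free: "{y, z} \<notin> R"
    if xyz: "{x, y, z} \<subseteq> W" "distinct [x, y, z]" "{x, y} \<in> R" "{x, z} \<in> R" for x y z
  proof
    assume yz: "{y, z} \<in> R"
    let ?B = "\<lambda>v. {b \<in> A. {v, b} \<notin> R}"
    \<comment> \<open>Blue edges from the triangle rule out at most three of the five vertices of
      \<open>A\<close>; two of the others serve as ends of the deleted edge.\<close>
    have "card (?B x \<union> ?B y \<union> ?B z) \<le> card (?B x) + card (?B y) + card (?B z)"
      by (meson add_le_mono1 card_Un_le le_trans)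
    also have "\<dots> \<le> 3"
      using few_blue[OF A, of x] few_blue[OF A, of y] few_blue[OF A, of z] xyz(1)
      by (auto simp: W_def)
    finally have "Suc (Suc 0) \<le> card (A - (?B x \<union> ?B y \<union> ?B z))"
      using A(2) fin by (subst card_Diff_subset) auto
    then obtain a b where "a \<in> A" "b \<in> A" "a \<noteq> b"
      "{x, a} \<in> R" "{y, a} \<in> R" "{z, a} \<in> R" "{x, b} \<in> R" "{y, b} \<in> R" "{z, b} \<in> R"
      by (auto simp: card_le_Suc_iff)
    with xyz yz A(1) have "contains_copy ({..<n}, R) (complete_minus_edge 5)"
      by (intro contains_copy_complete_minus_edge_5I[of a b x y z])
        (auto simp: W_def insert_commute)
    with no_red show False ..
  qed
  \<comment> \<open>An independent 5-set needs 5 * 6 / 2 = 15 vertices, and \<open>W\<close> has at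
    least 20 - 5 of them.\<close>
  have "\<exists>B \<subseteq> W. card B = 5 \<and> indep B R"
    by (rule indep_if_triangle_free) (use triangle_free card_W \<open>20 \<le> n\<close> in \<open>simp_all add: W_def\<close>)
  then obtain B where B: "B \<subseteq> W" "card B = 5" "indep B R"
    by blast
  have fin_B: "finite B"
    using B(1) finite_subset by (auto simp: W_def)
  have "card (W - B) = n - 10"
    using B fin_B card_W by (simp add: card_Diff_subset)
  then have "6 \<le> card (W - B)"
    using \<open>20 \<le> n\<close> by simp
  then obtain D where D: "D \<subseteq> W - B" "card D = 6"
    by (rule obtain_subset_with_card_n)
  \<comment> \<open>At most two of the five vertices of \<open>B\<close> are lost to blue edges from
    \<open>x\<close> or \<open>y\<close>. A common red neighbour in \<open>B \<subseteq> W\<close>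
    would close a red triangle in \<open>W\<close> if \<open>{x, y}\<close> were red.\<close>
  have "{x, y} \<notin> R" if xy: "x \<in> D" "y \<in> D" "x \<noteq> y" for x y
  proof -
    let ?B = "\<lambda>v. {b \<in> B. {v, b} \<notin> R}"
    have "card (?B x \<union> ?B y) \<le> card (?B x) + card (?B y)"
      by (rule card_Un_le)
    also have "\<dots> \<le> 2"
    proof -
      have "B \<subseteq> {..<n}" "x < n" "y < n" "x \<notin> B" "y \<notin> B"
        using B(1) D(1) xy by (auto simp: W_def)
      then show ?thesis
        using few_blue[of B x] few_blue[of B y] B by linarith
    qed
    finally have "?B x \<union> ?B y \<noteq> B"
      using B(2) by auto
    then obtain b where "b \<in> B" "{x, b} \<in> R" "{y, b} \<in> R"
      by auto
    then show ?thesis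
      using triangle_free[of b x y] xy B(1) D(1) by (auto simp: insert_commute)
  qed
  then have "contains_copy ({..<n}, [{..<n}]\<^bsup>2\<^esup> - R) (complete_minus_star 6 3)"
    using D
    by (intro copy_into_complete[of _ D] simple_graph_complete_minus_star)
      (auto simp: W_def complete_minus_star_def delete_edges_def complete_graph_def
        intro: card_ge_0_finite)
  with no_blue show False ..
qed

section \<open>Lower bound: a colouring of K_20\<close>

text \<open>Pairwise meeting edges of a graph form a star or a triangle, and a triangle has only
  three edges.\<close>

lemma pairwise_intersecting_doubletons:
  assumes "card a = 2" "card b = 2" "card c = 2" "card d = 2" "distinct [a, b, c, d]"
    and "a \<inter> b \<noteq> {}" "a \<inter> c \<noteq> {}" "a \<inter> d \<noteq> {}" "b \<inter> c \<noteq> {}" "b \<inter> d \<noteq> {}" "c \<inter> d \<noteq> {}"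
  shows "\<exists>v. v \<in> a \<and> v \<in> b \<and> v \<in> c \<and> v \<in> d"
proof -
  obtain v where v: "v \<in> a" "v \<in> b"
    using assms(6) by auto
  obtain u where u: "a = {v, u}" "u \<noteq> v"
    using assms(1) v by (auto simp: card_2_iff doubleton_eq_iff)
  obtain w where w: "b = {v, w}" "w \<noteq> v"
    using assms(2) v by (auto simp: card_2_iff doubleton_eq_iff)
  \<comment> \<open>An edge that meets \<open>a\<close> and \<open>b\<close> but avoids
    \<open>v\<close> is the third side of their triangle.\<close>
  have *: "e = {u, w}" if "card e = 2" "a \<inter> e \<noteq> {}" "b \<inter> e \<noteq> {}" "v \<notin> e" for e
    using that u w assms(5) by (auto simp: card_2_iff doubleton_eq_iff)
  have **: "v \<notin> e" if "card e = 2" "e \<inter> {u, w} \<noteq> {}" "e \<noteq> a" "e \<noteq> b" for e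
    using that u w by (auto simp: card_2_iff doubleton_eq_iff)
  have "v \<in> c"
  proof (rule ccontr)
    assume "v \<notin> c"
    then have c: "c = {u, w}"
      using *[of c] assms by blast
    then have "v \<notin> d"
      using **[of d] assms(4,5,11) by (auto simp: Int_commute)
    then show False
      using *[of d] c assms by simp
  qed
  moreover have "v \<in> d"
  proof (rule ccontr)
    assume "v \<notin> d"
    then have d: "d = {u, w}"
      using *[of d] assms by blast
    then show False
      using **[of c] assms(3,5,11) \<open>v \<in> c\<close> by auto
  qed
  ultimately show ?thesis
    using v by blast
qed

text \<open>A red K_5 - e would be five edges of K_5 through one vertex, which has degree four. A
  blue K_5 would split into two matchings of K_5, of at most two edges each.\<close>

lemma not_ramsey_arrows_20:
  "\<not> ramsey_arrows 20 (complete_minus_edge 5) (complete_graph 5)"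
proof -
  let ?K = "[{..<5::nat}]\<^bsup>2\<^esup>"
  \<comment> \<open>The Boolean selects one of the two copies; the 2-set is an edge of K_5, that is,
    a vertex of its line graph.\<close>
  define V where "V = (UNIV :: bool set) \<times> ?K"
  define adj :: "bool \<times> nat set \<Rightarrow> bool \<times> nat set \<Rightarrow> bool" where
    "adj = (\<lambda>x y. fst x = fst y \<and> snd x \<inter> snd y \<noteq> {})"
  have adj_sym: "adj x y \<longleftrightarrow> adj y x" for x y
    by (auto simp: adj_def)
  have "card ?K = 5 choose 2"
    by (simp add: card_nsets)
  then have "card V = 20"
    by (simp add: V_def card_cartesian_product choose_two)
  then obtain h where h: "bij_betw h {..<20::nat} V"
    by (metis card.infinite card_lessThan finite_lessThan finite_same_card_bij zero_neq_numeral)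
  \<comment> \<open>\<open>adj\<close> relates every element of \<open>V\<close> to itself, hence
    the demand \<open>i \<noteq> j\<close>.\<close>
  define R where "R = {{i, j} | i j. i < 20 \<and> j < 20 \<and> i \<noteq> j \<and> adj (h i) (h j)}"
  have R_iff: "{i, j} \<in> R \<longleftrightarrow> adj (h i) (h j)" if "i < 20" "j < 20" "i \<noteq> j" for i j
    using that adj_sym[of "h i" "h j"] by (auto simp: R_def doubleton_eq_iff)
  have "R \<subseteq> edges (complete_graph 20)"
    by (auto simp: R_def complete_graph_def)
  moreover have "\<not> contains_copy (verts (complete_graph 20), R) (complete_minus_edge 5)"
  proof
    assume "contains_copy (verts (complete_graph 20), R) (complete_minus_edge 5)"
    then obtain f where f: "inj_on f {..<5::nat}" "f ` {..<5} \<subseteq> {..<20}"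
      "\<And>e. e \<in> [{..<5}]\<^bsup>2\<^esup> \<Longrightarrow> e \<noteq> {0, 1} \<Longrightarrow> f ` e \<in> R"
      by (auto simp: contains_copy_def complete_minus_edge_def delete_edges_def complete_graph_def)
    define p where "p = (\<lambda>i. snd (h (f i)))"
    have V: "h (f i) \<in> V" if "i < 5" for i
      using that f(2) h by (auto simp: bij_betw_def)
    have adj: "adj (h (f i)) (h (f j))" if "i < 5" "j < 5" "i \<noteq> j" "{i, j} \<noteq> {0, 1}" for i j
    proof -
      have "{f i, f j} \<in> R"
        using f(3)[of "{i, j}"] that by auto
      moreover have "f i \<noteq> f j"
        using f(1) that by (auto simp: inj_on_def)
      ultimately show ?thesis
        using R_iff[of "f i" "f j"] f(2) that by auto
    qed
    \<comment> \<open>Vertex \<open>2\<close> is not an end of the deleted edge, so it is joined to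
      all others and fixes the copy.\<close>
    have same: "fst (h (f i)) = fst (h (f 2))" if "i < 5" for i
      using adj[of i 2] that by (cases "i = 2") (auto simp: adj_def doubleton_eq_iff)
    have meet: "p i \<inter> p j \<noteq> {}" if "i < 5" "j < 5" "i \<noteq> j" "{i, j} \<noteq> {0, 1}" for i j
      using adj[OF that] by (auto simp: adj_def p_def)
    have inj: "inj_on p {..<5}"
    proof (rule inj_onI)
      fix i j assume ij: "i \<in> {..<5::nat}" "j \<in> {..<5}" "p i = p j"
      then have "h (f i) = h (f j)"
        using same[of i] same[of j] by (simp add: p_def prod_eq_iff)
      then have "f i = f j"
        using ij f(2) inj_onD[OF bij_betw_imp_inj_on[OF h], of "f i" "f j"] by auto
      then show "i = j"
        using ij f(1) by (auto simp: inj_on_def)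
    qed
    then have neq: "p i \<noteq> p j" if "i < 5" "j < 5" "i \<noteq> j" for i j
      using that by (auto simp: inj_on_def)
    have pK: "p i \<in> ?K" if "i < 5" for i
      using V[OF that] by (auto simp: V_def p_def)
    then have card_p: "card (p i) = 2" if "i < 5" for i
      using that by (auto simp: nsets_def)
    \<comment> \<open>The vertices 0, 2, 3, 4 and 1, 2, 3, 4 span the two 4-cliques of K_5 - e; each
      is mapped to a star in K_5.\<close>
    obtain v where v: "v \<in> p 0" "v \<in> p 2" "v \<in> p 3" "v \<in> p 4"
      using pairwise_intersecting_doubletons[of "p 0" "p 2" "p 3" "p 4"]
      by (auto simp: card_p neq meet doubleton_eq_iff)
    obtain w where w: "w \<in> p 1" "w \<in> p 2" "w \<in> p 3" "w \<in> p 4"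
      using pairwise_intersecting_doubletons[of "p 1" "p 2" "p 3" "p 4"]
      by (auto simp: card_p neq meet doubleton_eq_iff)
    \<comment> \<open>Both centres lie in the distinct edges \<open>p 2\<close> and
      \<open>p 3\<close>, which share only one vertex.\<close>
    have "v = w"
      using v(2,3) w(2,3) card_p[of 2] card_p[of 3] neq[of 2 3]
      by (auto simp: card_2_iff doubleton_eq_iff)
    then have v_p: "v \<in> p i" if "i < 5" for i
      using that v w by (auto simp: less_Suc_eq numeral_eq_Suc)
    \<comment> \<open>Five different edges through \<open>v\<close> would need five other ends, but
      K_5 has only four.\<close>
    have "p ` {..<5} \<subseteq> (\<lambda>u. {v, u}) ` ({..<5} - {v})"
    proof
      fix e assume "e \<in> p ` {..<5}"
      then have "e \<in> ?K" "v \<in> e"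
        using pK v_p by auto
      then show "e \<in> (\<lambda>u. {v, u}) ` ({..<5} - {v})"
        by (auto elim!: nsets2_E)
    qed
    then have "card (p ` {..<5}) \<le> card ({..<5} - {v})"
      by (rule surj_card_le[rotated]) simp
    moreover have "v < 5"
      using pK[of 0] v(1) by (auto simp: nsets_def)
    ultimately show False
      using inj by (simp add: card_image)
  qed
  moreover have "\<not> contains_copy (verts (complete_graph 20), edges (complete_graph 20) - R) (complete_graph 5)"
  proof
    assume "contains_copy (verts (complete_graph 20), edges (complete_graph 20) - R) (complete_graph 5)"
    then obtain f where f: "inj_on f {..<5::nat}" "f ` {..<5} \<subseteq> {..<20}"
      "\<And>e. e \<in> [{..<5}]\<^bsup>2\<^esup> \<Longrightarrow> f ` e \<notin> R"
      by (auto simp: contains_copy_def complete_graph_def)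
    have not_adj: "\<not> adj (h (f i)) (h (f j))" if "i < 5" "j < 5" "i \<noteq> j" for i j
    proof -
      have "{f i, f j} \<notin> R"
        using f(3)[of "{i, j}"] that by auto
      moreover have "f i \<noteq> f j"
        using f(1) that by (auto simp: inj_on_def)
      ultimately show ?thesis
        using R_iff[of "f i" "f j"] f(2) that by auto
    qed
    have pK: "snd (h (f i)) \<in> ?K" if "i < 5" for i
    proof -
      have "h (f i) \<in> V"
        using that f(2) h by (auto simp: bij_betw_def)
      then show ?thesis
        by (auto simp: V_def)
    qed
    define S where "S b = {i. i < 5 \<and> fst (h (f i)) = b}" for b
    have fin: "finite (S b)" for b
      by (simp add: S_def)
    \<comment> \<open>The edges of K_5 chosen in one copy are pairwise disjoint, so they form a
      matching on five points.\<close>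
    have "2 * card (S b) \<le> 5" for b
    proof -
      have "card (\<Union>i\<in>S b. snd (h (f i))) = (\<Sum>i\<in>S b. card (snd (h (f i))))"
      proof (intro card_UN_disjoint ballI impI)
        fix i j assume "i \<in> S b" "j \<in> S b" "i \<noteq> j"
        then show "snd (h (f i)) \<inter> snd (h (f j)) = {}"
          using not_adj[of i j] by (auto simp: S_def adj_def)
      qed (use pK fin in \<open>auto simp: S_def nsets_def\<close>)
      also have "\<dots> = (\<Sum>i\<in>S b. 2)"
        using pK by (intro sum.cong) (auto simp: S_def nsets_def)
      finally have "2 * card (S b) = card (\<Union>i\<in>S b. snd (h (f i)))"
        by simp
      also have "\<dots> \<le> card {..<5::nat}"
        using pK by (intro card_mono) (auto simp: S_def nsets_def)
      finally show ?thesis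
        by simp
    qed
    from this[of True] this[of False] have "card (S True) + card (S False) \<le> 4"
      by presburger
    moreover have "card (S True) + card (S False) = card (S True \<union> S False)"
      using fin by (intro card_Un_disjoint[symmetric]) (auto simp: S_def)
    moreover have "S True \<union> S False = {..<5}"
      by (auto simp: S_def)
    ultimately show False
      by simp
  qed
  ultimately show ?thesis
    unfolding ramsey_arrows_def by blast
qed

section \<open>Equality of the Ramsey numbers\<close>

theorem corollary4:
  shows "\<forall>s\<in>{3, 4}. ramsey_number (complete_minus_edge 5) (complete_minus_star 6 s) =
    ramsey_number (complete_minus_edge 5) (complete_graph 5)"
proof
  fix s :: nat assume "s \<in> {3, 4}"
  then have s: "3 \<le> s"
    by auto
  \<comment> \<open>Both numbers are \<open>LEAST\<close> of the same predicate, so neither has to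
    be computed.\<close>
  have "(\<forall>n\<ge>N. ramsey_arrows n (complete_minus_edge 5) (complete_minus_star 6 s)) \<longleftrightarrow>
      (\<forall>n\<ge>N. ramsey_arrows n (complete_minus_edge 5) (complete_graph 5))" for N
  proof
    assume *: "\<forall>n\<ge>N. ramsey_arrows n (complete_minus_edge 5) (complete_minus_star 6 s)"
    show "\<forall>n\<ge>N. ramsey_arrows n (complete_minus_edge 5) (complete_graph 5)"
      using * contains_copy_complete_if_minus_star[of _ 5 s] unfolding ramsey_arrows_def
      by (simp add: numeral_eq_Suc) blast
  next
    assume *: "\<forall>n\<ge>N. ramsey_arrows n (complete_minus_edge 5) (complete_graph 5)"
    \<comment> \<open>The colouring of K_20 pushes \<open>N\<close> past 20, which supplies the
      lower bound on \<open>n\<close> that the upper bound argument needs.\<close>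
    then have "20 < N"
      using not_ramsey_arrows_20 by (meson not_less)
    then have "\<forall>n\<ge>N. ramsey_arrows n (complete_minus_edge 5) (complete_minus_star 6 3)"
      using * ramsey_arrows_minus_star_if_complete by simp
    then show "\<forall>n\<ge>N. ramsey_arrows n (complete_minus_edge 5) (complete_minus_star 6 s)"
      using contains_copy_complete_minus_star_mono[OF _ s] unfolding ramsey_arrows_def by blast
  qed
  then show "ramsey_number (complete_minus_edge 5) (complete_minus_star 6 s) =
      ramsey_number (complete_minus_edge 5) (complete_graph 5)"
    by (simp add: ramsey_number_def)
qed

end
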